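(* Let $\mathcal{X}\in\mathbb{C}^{I_1\times\cdots\times I_N}$ be a tensor with an independent Tucker decomposition $\mathcal{X}=[\![\mathcal{G};\mathbf{X}^{(1)},\ldots,\mathbf{X}^{(N)}]\!]$, where $\mathcal{G}\in\mathbb{C}^{J_1\times\cdots\times J_N}$ and $\mathbf{X}^{(n)}\in\mathbb{C}^{I_n\times J_n}$. Then $\mathrm{rank}_B(\mathcal{X})=\mathrm{rank}_B(\mathcal{G})$.
   Context: Mode-$n$ product: for $\mathcal{X}\in\mathbb{C}^{I_1\times\cdots\times I_N}$ and a matrix $\mathbf{A}\in\mathbb{C}^{J\times I_n}$, $[\mathcal{X}\times_n\mathbf{A}]_{i_1\cdots i_{n-1}ji_{n+1}\cdots i_N}=\sum_{i_n=1}^{I_n}x_{i_1\cdots i_N}a_{ji_n}$. Tucker decomposition: $\mathcal{X}=[\![\mathcal{G};\mathbf{X}^{(1)},\ldots,\mathbf{X}^{(N)}]\!]$ means $\mathcal{X}=\mathcal{G}\times_1\mathbf{X}^{(1)}\times_2\cdots\times_N\mathbf{X}^{(N)}$; it is independent if every factor matrix $\mathbf{X}^{(n)}$ has full column rank. CP rank: $\mathrm{rank}_{CP}(\mathcal{X})$ is the minimum integer $r$ such that $\mathcal{X}=\sum_{t=1}^r\mathbf{a}^{(1,t)}\circ\cdots\circ\mathbf{a}^{(N,t)}$ for some $\mathbf{a}^{(n,t)}\in\mathbb{C}^{I_n}$, where $\circ$ is the outer product of vectors. Border rank: for $\mathcal{X}\in\mathbb{C}^{I_1\times\cdots\times I_N}$,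 $$\mathrm{rank}_B(\mathcal{X})=\min\{r:\ \forall\epsilon>0\ \exists\,\mathcal{E}\in\mathbb{C}^{I_1\times\cdots\times I_N}\text{ with }\|\mathcal{E}\|_F\le\epsilon\text{ and }\mathrm{rank}_{CP}(\mathcal{X}+\mathcal{E})\le r\},$$ where $\|\mathcal{E}\|_F=(\sum|e_{i_1\cdots i_N}|^2)^{1/2}$ is the Frobenius norm. *)

theory Defs
  imports "Jordan_Normal_Form.DL_Rank" Complex_Main
begin

text \<open>
  A complex tensor of order \<open>N\<close> is a function on index lists of length \<open>N\<close>; its shape is the list
  of its \<open>N\<close> dimensions. Indices and modes are counted from \<open>0\<close>. A tensor of a given shape is
  required to vanish outside its index range, so equality of tensors of the same shape is equality
  of functions.
\<close>

type_synonym tensor = "nat list \<Rightarrow> complex"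

definition tensor_indices :: "nat list \<Rightarrow> nat list set" where
  "tensor_indices Is = {ix. list_all2 (<) ix Is}"

definition carrier_tensor :: "nat list \<Rightarrow> tensor set" where
  "carrier_tensor Is = {X. \<forall>ix. ix \<notin> tensor_indices Is \<longrightarrow> X ix = 0}"

text \<open>
  The dimension of mode \<open>n\<close> of \<open>X\<close> is meant to be \<open>dim_col A\<close>; the guard on \<open>ix ! n\<close> makes the
  result vanish outside the new index range (lemma \<open>mode_product_carrier\<close>).
\<close>

definition mode_product :: "nat \<Rightarrow> tensor \<Rightarrow> complex mat \<Rightarrow> tensor" where
  "mode_product n X A = (\<lambda>ix. if ix ! n < dim_row A
     then (\<Sum>i<dim_col A. X (ix[n := i]) * A $$ (ix ! n, i)) else 0)"

definition tucker_product :: "tensor \<Rightarrow> complex mat list \<Rightarrow> tensor" where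
  "tucker_product G Xs = fold (\<lambda>n T. mode_product n T (Xs ! n)) [0..<length Xs] G"

text \<open>The first argument of \<^const>\<open>vec_space.rank\<close> is the dimension of the column vectors.\<close>

definition full_column_rank :: "complex mat \<Rightarrow> bool" where
  "full_column_rank A \<longleftrightarrow> vec_space.rank (dim_row A) A = dim_col A"

definition outer_product :: "complex vec list \<Rightarrow> tensor" where
  "outer_product as = (\<lambda>ix. if ix \<in> tensor_indices (map dim_vec as)
     then (\<Prod>n<length as. (as ! n) $ (ix ! n)) else 0)"

definition cp_decomposable :: "nat list \<Rightarrow> tensor \<Rightarrow> nat \<Rightarrow> bool" where
  "cp_decomposable Is X r \<longleftrightarrow> (\<exists>a :: nat \<Rightarrow> complex vec list.
     (\<forall>t<r. map dim_vec (a t) = Is) \<and> X = (\<lambda>ix. \<Sum>t<r. outer_product (a t) ix))"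

definition cp_rank :: "nat list \<Rightarrow> tensor \<Rightarrow> nat" where
  "cp_rank Is X = (LEAST r. cp_decomposable Is X r)"

definition frobenius_norm :: "nat list \<Rightarrow> tensor \<Rightarrow> real" where
  "frobenius_norm Is E = sqrt (\<Sum>ix\<in>tensor_indices Is. (cmod (E ix))\<^sup>2)"

definition border_rank :: "nat list \<Rightarrow> tensor \<Rightarrow> nat" where
  "border_rank Is X = (LEAST r. \<forall>\<epsilon>>0. \<exists>E\<in>carrier_tensor Is.
     frobenius_norm Is E \<le> \<epsilon> \<and> cp_rank Is (\<lambda>ix. X ix + E ix) \<le> r)"

lemma finite_tensor_indices: "finite (tensor_indices Is)"
proof (rule finite_subset)
  show "tensor_indices Is \<subseteq> {ix. set ix \<subseteq> {..<Suc (sum_list Is)} \<and> length ix = length Is}"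
  proof
    fix ix assume "ix \<in> tensor_indices Is"
    then have *: "length ix = length Is" "\<And>i. i < length Is \<Longrightarrow> ix ! i < Is ! i"
      by (auto simp: tensor_indices_def list_all2_conv_all_nth)
    have "ix ! i \<le> sum_list Is" if "i < length Is" for i
      using *(2)[OF that] member_le_sum_list[OF nth_mem[OF that]] by linarith
    then show "ix \<in> {ix. set ix \<subseteq> {..<Suc (sum_list Is)} \<and> length ix = length Is}"
      using *(1) by (auto simp: in_set_conv_nth less_Suc_eq_le)
  qed
  show "finite {ix. set ix \<subseteq> {..<Suc (sum_list Is)} \<and> length ix = length Is}"
    by (rule finite_lists_length_eq) simp
qed

lemma mode_product_carrier:
  assumes "X \<in> carrier_tensor Is" and "n < length Is" and "dim_col A = Is ! n"
  shows "mode_product n X A \<in> carrier_tensor (Is[n := dim_row A])"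
proof -
  have "X (ix[n := i]) = 0"
    if "ix \<notin> tensor_indices (Is[n := dim_row A])" "ix ! n < dim_row A" for ix i
  proof -
    have "ix[n := i] \<notin> tensor_indices Is"
      using that assms(2)
      by (auto simp: tensor_indices_def list_all2_conv_all_nth nth_list_update split: if_splits)
    then show ?thesis using assms(1) by (auto simp: carrier_tensor_def)
  qed
  then show ?thesis
    by (auto simp: carrier_tensor_def mode_product_def)
qed

end

theory Submission
  imports Defs
begin

text \<open>
  Multiplying one mode by a matrix is a bounded linear map that sends rank-one tensors to rank-one
  tensors, so it cannot increase the border rank. A matrix of full column rank has a left inverse,
  and multiplying the same mode by it undoes the product, so the border rank does not decrease
  either. Applying this to the modes one after the other gives the theorem.
\<close>

section \<open>Left inverses of matrices of full column rank\<close>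

text \<open>The rank is the size of a maximal independent subset of the set of columns. If it equals
  \<open>nc\<close>, that set has at least \<open>nc\<close> elements, so no column repeats.
  Independence of a set does not see repetitions, hence the separate lemma.\<close>

lemma (in vec_space) full_rank_distinct_cols:
  assumes A: "A \<in> carrier_mat n nc" and "rank A = nc"
  shows "distinct (cols A)"
proof -
  obtain S where S: "maximal S (\<lambda>T. T \<subseteq> set (cols A) \<and> lin_indpt T)"
    using maximal_exists[of "\<lambda>T. T \<subseteq> set (cols A) \<and> lin_indpt T" "card (set (cols A))" "{}"]
    by (meson List.finite_set card_mono empty_iff empty_subsetI finite_lin_indpt2 rev_finite_subset)
  have "card S = nc"
    using rank_card_indpt[OF A S] assms by simp
  moreover have "card S \<le> card (set (cols A))"
    using S by (simp add: card_mono maximal_def)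
  ultimately have "card (set (cols A)) = length (cols A)"
    using card_length[of "cols A"] A by simp
  then show ?thesis by (rule card_distinct)
qed

lemma (in vec_space) full_rank_kernel:
  assumes "A \<in> carrier_mat n nc" "rank A = nc" "v \<in> carrier_vec nc" "A *\<^sub>v v = 0\<^sub>v n"
  shows "v = 0\<^sub>v nc"
  using full_rank_distinct_cols[OF assms(1,2)] full_rank_lin_indpt[OF assms(1,2)]
    lin_depI[OF assms(1,3) _ assms(4)] by blast

text \<open>The left inverse is the Moore--Penrose inverse: the inverse of the Gram matrix, times the
  adjoint.\<close>

lemma full_column_rank_left_inverse:
  assumes "full_column_rank A"
  obtains B where "B \<in> carrier_mat (dim_col A) (dim_row A)" "B * A = 1\<^sub>m (dim_col A)"
proof -
  let ?m = "dim_row A" and ?n = "dim_col A"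
  define H where "H = map_mat conjugate (transpose_mat A)"
  have A: "A \<in> carrier_mat ?m ?n" by simp
  have H: "H \<in> carrier_mat ?n ?m" by (auto simp: H_def)
  have HA: "H * A \<in> carrier_mat ?n ?n" using H by auto
  \<comment> \<open>If \<open>v\<close> is in the kernel of the Gram matrix, then the squared norm
    of \<open>A *\<^sub>v v\<close> is the product of the conjugate of \<open>v\<close> with
    \<open>H * A *\<^sub>v v\<close>, hence 0. So \<open>v\<close> is in the kernel of
    \<open>A\<close>, which is trivial.\<close>
  have "det (H * A) \<noteq> 0"
  proof
    assume "det (H * A) = 0"
    then obtain v where v: "v \<in> carrier_vec ?n" "v \<noteq> 0\<^sub>v ?n" "H * A *\<^sub>v v = 0\<^sub>v ?n"
      using det_0_iff_vec_prod_zero_field[OF HA] by auto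
    let ?w = "A *\<^sub>v v"
    have w: "?w \<in> carrier_vec ?m" by (rule mult_mat_vec_carrier[OF A v(1)])
    have Hw: "H *\<^sub>v ?w = 0\<^sub>v ?n"
      using assoc_mult_mat_vec[OF H A v(1)] v(3) by simp
    \<comment> \<open>The scalar product is bilinear, without conjugation, so moving
      \<open>H\<close> across it produces the transpose of \<open>H\<close>, the entrywise conjugate
      of \<open>A\<close>.\<close>
    have conj: "transpose_mat H *\<^sub>v conjugate v = conjugate ?w"
    proof (rule eq_vecI)
      fix i assume "i < dim_vec (conjugate ?w)"
      then show "(transpose_mat H *\<^sub>v conjugate v) $ i = conjugate ?w $ i"
        using v(1) H by (auto simp: H_def scalar_prod_def sum_conjugate)
    qed (use H in auto)
    have "conjugate ?w \<bullet> ?w = conjugate v \<bullet> (H *\<^sub>v ?w)"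
      using transpose_vec_mult_scalar[OF H w, of "conjugate v"] v(1) conj by simp
    also have "\<dots> = 0" using Hw v(1) by simp
    finally have "?w \<bullet>c ?w = 0"
      using w comm_scalar_prod[OF w, of "conjugate ?w"] by simp
    then have "?w = 0\<^sub>v ?m" using w by simp
    then show False using vec_space.full_rank_kernel[OF A _ v(1)] assms v(2)
      by (simp add: full_column_rank_def)
  qed
  then obtain M where M: "M \<in> carrier_mat ?n ?n" "M * (H * A) = 1\<^sub>m ?n"
    using det_non_zero_imp_unit[OF HA, of "()"] by (auto simp: Units_def ring_mat_def)
  show thesis
  proof
    show "M * H \<in> carrier_mat ?n ?m" using M H by simp
    show "M * H * A = 1\<^sub>m ?n" using assoc_mult_mat[OF M(1) H A] M(2) by simp
  qed
qed

section \<open>Mode products\<close>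

lemma tensor_indices_iff:
  "ix \<in> tensor_indices Is \<longleftrightarrow> length ix = length Is \<and> (\<forall>n<length Is. ix ! n < Is ! n)"
  by (auto simp: tensor_indices_def list_all2_conv_all_nth)

lemma tensor_indices_update:
  assumes "ix \<in> tensor_indices (Is[n := d])" "n < length Is" "i < Is ! n"
  shows "ix[n := i] \<in> tensor_indices Is"
  using assms by (auto simp: tensor_indices_iff nth_list_update)

lemma outer_product_carrier: "outer_product as \<in> carrier_tensor (map dim_vec as)"
  by (auto simp: outer_product_def carrier_tensor_def)

lemma mode_product_add:
  "mode_product n (\<lambda>ix. X ix + Y ix) A = (\<lambda>ix. mode_product n X A ix + mode_product n Y A ix)"
  by (auto simp: mode_product_def fun_eq_iff sum.distrib ring_distribs)

lemma mode_product_sum: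
  "mode_product n (\<lambda>ix. \<Sum>t\<in>T. X t ix) A = (\<lambda>ix. \<Sum>t\<in>T. mode_product n (X t) A ix)"
  by (auto simp: mode_product_def fun_eq_iff sum_distrib_right intro: sum.swap)

text \<open>Only the factor of mode \<open>n\<close> depends on the summation index. The other
  factors come out of the sum, which then is an entry of \<open>A *\<^sub>v as ! n\<close>.\<close>

lemma mode_product_outer_product:
  assumes n: "n < length as" and A: "dim_col A = dim_vec (as ! n)"
  shows "mode_product n (outer_product as) A = outer_product (as[n := A *\<^sub>v as ! n])"
proof
  fix ix
  let ?Is = "map dim_vec as" and ?bs = "as[n := A *\<^sub>v as ! n]"
  have Is': "?Is[n := dim_row A] = map dim_vec ?bs" by (simp add: map_update)
  show "mode_product n (outer_product as) A ix = outer_product ?bs ix"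
  proof (cases "ix \<in> tensor_indices (map dim_vec ?bs)")
    case False
    then show ?thesis
      using mode_product_carrier[OF outer_product_carrier[of as], of n A] outer_product_carrier[of ?bs]
        n A Is'
      by (auto simp: carrier_tensor_def)
  next
    case True
    let ?P = "\<Prod>m\<in>{..<length as} - {n}. as ! m $ (ix ! m)"
    have len: "length ix = length as" and ixn: "ix ! n < dim_row A"
      using True n by (auto simp: tensor_indices_iff)
    have "outer_product as (ix[n := i]) = as ! n $ i * ?P" if "i < dim_col A" for i
    proof -
      have "ix[n := i] \<in> tensor_indices ?Is"
        using True that n A by (intro tensor_indices_update[where d = "dim_row A"]) (simp_all add: Is')
      then have "outer_product as (ix[n := i]) = (\<Prod>m<length as. as ! m $ (ix[n := i] ! m))"
        by (simp add: outer_product_def)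
      also have "\<dots> = as ! n $ i * (\<Prod>m\<in>{..<length as} - {n}. as ! m $ (ix[n := i] ! m))"
        using n len by (subst prod.remove[of _ n]) auto
      finally show ?thesis by simp
    qed
    then have "mode_product n (outer_product as) A ix = (\<Sum>i<dim_col A. as ! n $ i * ?P * A $$ (ix ! n, i))"
      using ixn by (simp add: mode_product_def)
    also have "\<dots> = (A *\<^sub>v as ! n) $ (ix ! n) * ?P"
      using ixn A by (auto simp: scalar_prod_def sum_distrib_left sum_distrib_right atLeast0LessThan
          intro!: sum.cong)
    also have "\<dots> = (\<Prod>m<length as. ?bs ! m $ (ix ! m))"
      using n by (subst prod.remove[of "{..<length as}" n]) auto
    also have "\<dots> = outer_product ?bs ix"
      using True by (simp add: outer_product_def)
    finally show ?thesis .
  qed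
qed

text \<open>Two products along the same mode amount to one product with \<open>B * A\<close>, after
  exchanging the two sums. Outside the index range both sides vanish.\<close>

lemma mode_product_left_inverse:
  assumes X: "X \<in> carrier_tensor Is" and n: "n < length Is" and A: "dim_col A = Is ! n"
    and B: "B \<in> carrier_mat (dim_col A) (dim_row A)" and BA: "B * A = 1\<^sub>m (dim_col A)"
  shows "mode_product n (mode_product n X A) B = X"
proof
  fix ix
  have "mode_product n (mode_product n X A) B \<in> carrier_tensor (Is[n := dim_row A, n := dim_row B])"
    using X n A B by (intro mode_product_carrier) auto
  then have car: "mode_product n (mode_product n X A) B \<in> carrier_tensor Is"
    using A B by simp
  show "mode_product n (mode_product n X A) B ix = X ix"
  proof (cases "ix \<in> tensor_indices Is")
    case False
    then show ?thesis using car X by (auto simp: carrier_tensor_def)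
  next
    case True
    then have len: "length ix = length Is" and ixn: "ix ! n < dim_col A"
      using n A by (auto simp: tensor_indices_iff)
    have "mode_product n (mode_product n X A) B ix
        = (\<Sum>i<dim_row A. \<Sum>j<dim_col A. X (ix[n := j]) * (B $$ (ix ! n, i) * A $$ (i, j)))"
      using len n ixn B
      by (auto simp: mode_product_def sum_distrib_left sum_distrib_right mult_ac intro!: sum.cong)
    also have "\<dots> = (\<Sum>j<dim_col A. X (ix[n := j]) * (\<Sum>i<dim_row A. B $$ (ix ! n, i) * A $$ (i, j)))"
      by (subst sum.swap) (simp add: sum_distrib_left)
    also have "\<dots> = (\<Sum>j<dim_col A. X (ix[n := j]) * (B * A) $$ (ix ! n, j))"
      using ixn B by (auto simp: scalar_prod_def atLeast0LessThan intro!: sum.cong)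
    also have "\<dots> = (\<Sum>j<dim_col A. if j = ix ! n then X (ix[n := j]) else 0)"
      using ixn unfolding BA by (intro sum.cong) auto
    also have "\<dots> = X ix" using ixn by simp
    finally show ?thesis .
  qed
qed

section \<open>Rank and border rank under mode products\<close>

text \<open>A scalar cannot be absorbed into an empty list of vectors, so order \<open>0\<close> is excluded.\<close>

lemma cp_decomposable_exists:
  assumes X: "X \<in> carrier_tensor Is" and "Is \<noteq> []"
  shows "\<exists>r. cp_decomposable Is X r"
proof -
  let ?K = "card (tensor_indices Is)"
  obtain f where f: "bij_betw f {..<?K} (tensor_indices Is)"
    using ex_bij_betw_nat_finite[OF finite_tensor_indices] by (auto simp: atLeast0LessThan)
  \<comment> \<open>One rank-one term per index: \<open>a jx\<close> lists the unit vectors at the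
    positions \<open>jx ! n\<close>, the first of them scaled by \<open>X jx\<close>. Its outer
    product has the entry \<open>X jx\<close> at \<open>jx\<close> and 0 elsewhere.\<close>
  define a where "a = (\<lambda>jx. map (\<lambda>n. vec (Is ! n)
    (\<lambda>i. if i = jx ! n then (if n = 0 then X jx else 1) else 0)) [0..<length Is])"
  have dims: "map dim_vec (a jx) = Is" for jx
    by (auto simp: a_def intro: nth_equalityI)
  have outer: "outer_product (a jx) ix = (if jx = ix then X ix else 0)"
    if ij: "ix \<in> tensor_indices Is" "jx \<in> tensor_indices Is" for ix jx
  proof -
    have "outer_product (a jx) ix
        = (\<Prod>n<length Is. if ix ! n = jx ! n then (if n = 0 then X jx else 1) else 0)"
      using ij dims by (auto simp: outer_product_def a_def tensor_indices_iff intro!: prod.cong)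
    also have "\<dots> = (if jx = ix then X ix else 0)"
    proof (cases "jx = ix")
      case True
      then show ?thesis using \<open>Is \<noteq> []\<close> by simp
    next
      case False
      then obtain n where "n < length Is" "ix ! n \<noteq> jx ! n"
        using ij nth_equalityI[of jx ix] by (metis tensor_indices_iff)
      then have "\<exists>n\<in>{..<length Is}. (if ix ! n = jx ! n then (if n = 0 then X jx else 1) else 0) = 0"
        by (intro bexI[of _ n]) auto
      then show ?thesis
        using False by (simp add: prod_zero)
    qed
    finally show ?thesis .
  qed
  have "X ix = (\<Sum>t<?K. outer_product (a (f t)) ix)" for ix
  proof (cases "ix \<in> tensor_indices Is")
    case False
    then show ?thesis using X dims by (auto simp: carrier_tensor_def outer_product_def)
  next
    case True
    have "(\<Sum>t<?K. outer_product (a (f t)) ix) = (\<Sum>jx\<in>tensor_indices Is. outer_product (a jx) ix)"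
      by (rule sum.reindex_bij_betw[OF f])
    also have "\<dots> = (\<Sum>jx\<in>tensor_indices Is. if jx = ix then X ix else 0)"
      using True outer by (intro sum.cong) auto
    also have "\<dots> = X ix" using True by (simp add: finite_tensor_indices)
    finally show ?thesis by simp
  qed
  then show ?thesis
    unfolding cp_decomposable_def using dims by (intro exI[of _ ?K] exI[of _ "\<lambda>t. a (f t)"]) auto
qed

text \<open>By linearity the product acts on each of the \<open>r\<close> rank-one terms separately,
  and each stays an outer product.\<close>

lemma cp_decomposable_mode_product:
  assumes "cp_decomposable Is X r" "n < length Is" "dim_col A = Is ! n"
  shows "cp_decomposable (Is[n := dim_row A]) (mode_product n X A) r"
proof -
  obtain a where a: "\<And>t. t < r \<Longrightarrow> map dim_vec (a t) = Is"
    and X: "X = (\<lambda>ix. \<Sum>t<r. outer_product (a t) ix)"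
    using assms(1) by (auto simp: cp_decomposable_def)
  let ?b = "\<lambda>t. (a t)[n := A *\<^sub>v a t ! n]"
  have "mode_product n (outer_product (a t)) A = outer_product (?b t)" if "t < r" for t
    using a[OF that] assms(2,3) by (intro mode_product_outer_product) auto
  then have "mode_product n X A = (\<lambda>ix. \<Sum>t<r. outer_product (?b t) ix)"
    unfolding X mode_product_sum by simp
  moreover have "map dim_vec (?b t) = Is[n := dim_row A]" if "t < r" for t
    using a[OF that] by (simp add: map_update)
  ultimately show ?thesis
    unfolding cp_decomposable_def by (intro exI[of _ ?b]) auto
qed

lemma cp_rank_mode_product:
  assumes "X \<in> carrier_tensor Is" "n < length Is" "dim_col A = Is ! n"
  shows "cp_rank (Is[n := dim_row A]) (mode_product n X A) \<le> cp_rank Is X"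
proof -
  \<comment> \<open>The \<open>LEAST\<close> is attained because some decomposition exists;
    \<open>n < length Is\<close> makes the shape nonempty, as this requires.\<close>
  have "cp_decomposable Is X (cp_rank Is X)"
    unfolding cp_rank_def using assms by (intro LeastI_ex[of "cp_decomposable Is X"] cp_decomposable_exists) auto
  from cp_decomposable_mode_product[OF this assms(2,3)]
  show ?thesis unfolding cp_rank_def[of "Is[n := dim_row A]"] by (rule Least_le)
qed

lemma norm_le_frobenius_norm:
  assumes "ix \<in> tensor_indices Is"
  shows "cmod (E ix) \<le> frobenius_norm Is E"
  unfolding frobenius_norm_def
  using member_le_sum[OF assms, of "\<lambda>ix. (cmod (E ix))\<^sup>2"] finite_tensor_indices
  by (intro real_le_rsqrt) auto

text \<open>Each entry of the product is at most a constant times the norm of \<open>E\<close>;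
  summing squares over the finite index range adds the square root of its size. The constant depends
  on \<open>A\<close> and the shape, not on \<open>E\<close>.\<close>

lemma frobenius_norm_mode_product:
  assumes n: "n < length Is" and A: "dim_col A = Is ! n"
  shows "\<exists>C\<ge>0. \<forall>E. frobenius_norm (Is[n := dim_row A]) (mode_product n E A) \<le> C * frobenius_norm Is E"
proof -
  let ?J = "tensor_indices (Is[n := dim_row A])"
  \<comment> \<open>A crude bound on the absolute sum of any single row of \<open>A\<close>.\<close>
  define M where "M = (\<Sum>k<dim_row A. \<Sum>i<dim_col A. cmod (A $$ (k, i)))"
  have M: "0 \<le> M" unfolding M_def by (intro sum_nonneg) auto
  have "frobenius_norm (Is[n := dim_row A]) (mode_product n E A) \<le> (sqrt (card ?J) * M) * frobenius_norm Is E"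
    for E
  proof -
    let ?F = "frobenius_norm Is E"
    have F: "0 \<le> ?F" by (auto simp: frobenius_norm_def intro: sum_nonneg)
    have "cmod (mode_product n E A ix) \<le> M * ?F" if ix: "ix \<in> ?J" for ix
    proof -
      have ixn: "ix ! n < dim_row A"
        using ix n by (auto simp: tensor_indices_iff)
      have "cmod (mode_product n E A ix) \<le> (\<Sum>i<dim_col A. cmod (E (ix[n := i]) * A $$ (ix ! n, i)))"
        using ixn by (simp add: mode_product_def norm_sum)
      also have "\<dots> \<le> (\<Sum>i<dim_col A. ?F * cmod (A $$ (ix ! n, i)))"
        using ix n A
        by (intro sum_mono) (auto simp: norm_mult intro!: mult_right_mono norm_le_frobenius_norm
            tensor_indices_update)
      also have "\<dots> = (\<Sum>i<dim_col A. cmod (A $$ (ix ! n, i))) * ?F"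
        by (simp add: sum_distrib_left mult.commute)
      also have "\<dots> \<le> M * ?F"
        unfolding M_def using ixn F
        by (intro mult_right_mono member_le_sum[where f = "\<lambda>k. \<Sum>i<dim_col A. cmod (A $$ (k, i))"])
          (auto intro: sum_nonneg)
      finally show ?thesis .
    qed
    then have "(\<Sum>ix\<in>?J. (cmod (mode_product n E A ix))\<^sup>2) \<le> (\<Sum>ix\<in>?J. (M * ?F)\<^sup>2)"
      by (intro sum_mono power_mono) auto
    then have "frobenius_norm (Is[n := dim_row A]) (mode_product n E A) \<le> sqrt (card ?J * (M * ?F)\<^sup>2)"
      by (simp add: frobenius_norm_def)
    also have "\<dots> = (sqrt (card ?J) * M) * ?F"
      using M F by (simp add: real_sqrt_mult)
    finally show ?thesis .
  qed
  then show ?thesis using M by (intro exI[of _ "sqrt (card ?J) * M"]) auto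
qed

text \<open>The property minimised in \<open>border_rank\<close>. Its equivalence for every
  \<open>r\<close> makes two border ranks equal.\<close>

definition border_rank_le :: "nat list \<Rightarrow> tensor \<Rightarrow> nat \<Rightarrow> bool" where
  "border_rank_le Is X r \<longleftrightarrow> (\<forall>\<epsilon>>0. \<exists>E\<in>carrier_tensor Is.
     frobenius_norm Is E \<le> \<epsilon> \<and> cp_rank Is (\<lambda>ix. X ix + E ix) \<le> r)"

text \<open>The image of a small perturbation of \<open>X\<close> is a small perturbation of the
  image of \<open>X\<close>, and its CP rank has not grown.\<close>

lemma border_rank_le_mode_product:
  assumes X: "X \<in> carrier_tensor Is" and n: "n < length Is" and A: "dim_col A = Is ! n"
    and le: "border_rank_le Is X r"
  shows "border_rank_le (Is[n := dim_row A]) (mode_product n X A) r"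
  unfolding border_rank_le_def
proof (intro allI impI)
  fix \<epsilon> :: real assume \<epsilon>: "\<epsilon> > 0"
  obtain C where C: "C \<ge> 0"
    "\<And>E. frobenius_norm (Is[n := dim_row A]) (mode_product n E A) \<le> C * frobenius_norm Is E"
    using frobenius_norm_mode_product[OF n A] by auto
  \<comment> \<open>Dividing by \<open>C + 1\<close> covers the case \<open>C = 0\<close>.\<close>
  have "\<epsilon> / (C + 1) > 0" using \<epsilon> C(1) by simp
  then obtain E where E: "E \<in> carrier_tensor Is" "frobenius_norm Is E \<le> \<epsilon> / (C + 1)"
    "cp_rank Is (\<lambda>ix. X ix + E ix) \<le> r"
    using le unfolding border_rank_le_def by blast
  have "C * frobenius_norm Is E \<le> C * (\<epsilon> / (C + 1))"
    using E(2) C(1) by (rule mult_left_mono)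
  also have "\<dots> \<le> \<epsilon>" using C(1) \<epsilon> by (simp add: field_simps)
  finally have small: "frobenius_norm (Is[n := dim_row A]) (mode_product n E A) \<le> \<epsilon>"
    using C(2)[of E] by linarith
  have "(\<lambda>ix. X ix + E ix) \<in> carrier_tensor Is"
    using X E(1) by (auto simp: carrier_tensor_def)
  from cp_rank_mode_product[OF this n A] E(3)
  have "cp_rank (Is[n := dim_row A]) (\<lambda>ix. mode_product n X A ix + mode_product n E A ix) \<le> r"
    by (simp add: mode_product_add)
  then show "\<exists>E\<in>carrier_tensor (Is[n := dim_row A]). frobenius_norm (Is[n := dim_row A]) E \<le> \<epsilon>
      \<and> cp_rank (Is[n := dim_row A]) (\<lambda>ix. mode_product n X A ix + E ix) \<le> r"
    using small mode_product_carrier[OF E(1) n A] by blast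
qed

lemma border_rank_mode_product:
  assumes X: "X \<in> carrier_tensor Is" and n: "n < length Is" and A: "dim_col A = Is ! n"
    and rank: "full_column_rank A"
  shows "border_rank (Is[n := dim_row A]) (mode_product n X A) = border_rank Is X"
proof -
  obtain B where B: "B \<in> carrier_mat (dim_col A) (dim_row A)" "B * A = 1\<^sub>m (dim_col A)"
    using full_column_rank_left_inverse[OF rank] .
  have "border_rank_le (Is[n := dim_row A]) (mode_product n X A) r \<longleftrightarrow> border_rank_le Is X r" for r
  proof
    assume "border_rank_le (Is[n := dim_row A]) (mode_product n X A) r"
    \<comment> \<open>Multiplying by \<open>B\<close> restores both the tensor and its shape, as
      \<open>dim_row B\<close> is the old dimension \<open>Is ! n\<close>.\<close>
    then have "border_rank_le (Is[n := dim_row A, n := dim_row B]) (mode_product n (mode_product n X A) B) r"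
      using n B(1) by (intro border_rank_le_mode_product[OF mode_product_carrier[OF X n A]]) auto
    then show "border_rank_le Is X r"
      using mode_product_left_inverse[OF X n A B] A B(1) by simp
  qed (rule border_rank_le_mode_product[OF X n A])
  then show ?thesis by (simp add: border_rank_def border_rank_le_def)
qed

theorem theorem11:
  fixes N :: nat and Is Js :: "nat list" and X G :: tensor and Xs :: "complex mat list"
  assumes "1 \<le> N" and "length Is = N" and "length Js = N" and "length Xs = N"
    and "X \<in> carrier_tensor Is" and "G \<in> carrier_tensor Js"
    and "\<And>n. n < N \<Longrightarrow> Xs ! n \<in> carrier_mat (Is ! n) (Js ! n)"
    and tucker: "X = tucker_product G Xs"
    and independent: "\<And>n. n < N \<Longrightarrow> full_column_rank (Xs ! n)"
  shows "border_rank Is X = border_rank Js G"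
proof -
  \<comment> \<open>\<open>?T k\<close> is the product over the first \<open>k\<close> modes. Its
    shape \<open>?S k\<close> has the new dimensions in these modes and those of the core in the
    rest. The induction also carries membership in the carrier, which the single-mode lemma
    requires.\<close>
  let ?T = "\<lambda>k. fold (\<lambda>n T. mode_product n T (Xs ! n)) [0..<k] G"
  let ?S = "\<lambda>k. take k Is @ drop k Js"
  have "?T k \<in> carrier_tensor (?S k) \<and> border_rank (?S k) (?T k) = border_rank Js G" if "k \<le> N" for k
    using that
  proof (induction k)
    case 0
    then show ?case using assms(6) by simp
  next
    case (Suc k)
    then have k: "k < N" and IH: "?T k \<in> carrier_tensor (?S k)"
      "border_rank (?S k) (?T k) = border_rank Js G" by auto
    have dims: "dim_row (Xs ! k) = Is ! k" "dim_col (Xs ! k) = ?S k ! k"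
      using assms(7)[OF k] k assms(2,3) by (auto simp: nth_append)
    have len: "k < length (?S k)" using k assms(2,3) by simp
    \<comment> \<open>Mode \<open>k\<close> is the first position of \<open>?S k\<close> still taken
      from \<open>Js\<close>.\<close>
    have step: "?S (Suc k) = (?S k)[k := dim_row (Xs ! k)]"
      using k assms(2,3) dims(1)
      by (simp add: list_update_append take_Suc_conv_app_nth Cons_nth_drop_Suc[symmetric])
    have "?T (Suc k) = mode_product k (?T k) (Xs ! k)" by simp
    then show ?case
      using mode_product_carrier[OF IH(1) len dims(2)]
        border_rank_mode_product[OF IH(1) len dims(2) independent[OF k]] IH(2) step
      by metis
  qed
  from this[of N] show ?thesis
    using assms(2-4) tucker by (simp add: tucker_product_def)
qed

end
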